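(* Let $(C,\mathcal H_C,\Sigma,E)$ be a Heyting-valued estimate consensus protocol. Inconsistent propositions are not both safe in compatible states: if $p,q\in\mathcal H_C$ satisfy $p\wedge q=\bot$, then for any compatible states $w_1,w_2$ of $\Sigma$ it is not the case that both $S(p,w_1)$ and $S(q,w_2)$ hold.
   Context: A Heyting-valued estimate consensus protocol $(C,\mathcal H_C,\Sigma,E)$ consists of: a set $C$ of consensus values; a Heyting algebra $\mathcal H_C$ (with top $\top$, bottom $\bot$, implication $\Rightarrow$, and $\neg p:=p\Rightarrow\bot$), whose elements are called propositions; a category $\Sigma$ whose objects are called (protocol) states and whose morphisms are called (protocol) executions; and a functor $E\colon\Sigma\to\mathcal H_C$ (with $\mathcal H_C$ viewed as a poset category), called the estimator, such that for every state $w$ and every $p\in\mathcal H_C$: if $(Ew\Rightarrow p)=\top$ then $\neg(Ew\Rightarrow\neg p)=\top$. A proposition $p$ is safe in the state $w$, written $S(p,w)$, if for every execution $w\to w'$ in $\Sigma$ one has $(Ew'\Rightarrow p)=\top$. States $w_1,w_2$ are compatible if there exist a state $w_3$ and executions $w_1\to w_3\leftarrow w_2$.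
   Formalization: The Heyting algebra is additionally assumed nontrivial (bottom differs from top); in the one-element algebra every proposition is safe in every state and each state is compatible with itself, so the claim as stated fails there. *)

theory Defs
  imports Main
begin

class heyting_algebra = bounded_lattice +
  fixes himp :: "'a \<Rightarrow> 'a \<Rightarrow> 'a"  (infixr "\<rightarrow>\<^sub>H" 60)
  assumes himp_residuation: "inf r p \<le> q \<longleftrightarrow> r \<le> p \<rightarrow>\<^sub>H q"

definition hneg :: "'a::heyting_algebra \<Rightarrow> 'a"  ("\<not>\<^sub>H _" [70] 70)
  where "\<not>\<^sub>H p = (p \<rightarrow>\<^sub>H bot)"

record ('o, 'm) cat =
  Obj :: "'o set"
  Arr :: "'m set"
  Dom :: "'m \<Rightarrow> 'o"
  Cod :: "'m \<Rightarrow> 'o"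
  Ide :: "'o \<Rightarrow> 'm"
  Comp :: "'m \<Rightarrow> 'm \<Rightarrow> 'm"  \<comment> \<open>\<open>Comp K g f\<close> is \<open>g\<close> after \<open>f\<close>\<close>

definition Hom :: "('o, 'm) cat \<Rightarrow> 'o \<Rightarrow> 'o \<Rightarrow> 'm set"
  where "Hom K a b = {f \<in> Arr K. Dom K f = a \<and> Cod K f = b}"

definition is_category :: "('o, 'm) cat \<Rightarrow> bool"
  where "is_category K \<longleftrightarrow>
    (\<forall>f\<in>Arr K. Dom K f \<in> Obj K \<and> Cod K f \<in> Obj K) \<and>
    (\<forall>a\<in>Obj K. Ide K a \<in> Hom K a a) \<and>
    (\<forall>f\<in>Arr K. \<forall>g\<in>Arr K. Cod K f = Dom K g \<longrightarrow>
       Comp K g f \<in> Hom K (Dom K f) (Cod K g)) \<and>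
    (\<forall>f\<in>Arr K. Comp K f (Ide K (Dom K f)) = f \<and> Comp K (Ide K (Cod K f)) f = f) \<and>
    (\<forall>f\<in>Arr K. \<forall>g\<in>Arr K. \<forall>h\<in>Arr K. Cod K f = Dom K g \<longrightarrow> Cod K g = Dom K h \<longrightarrow>
       Comp K h (Comp K g f) = Comp K (Comp K h g) f)"

record ('o, 'm, 'p, 'n) fctr =
  on_obj :: "'o \<Rightarrow> 'p"
  on_arr :: "'m \<Rightarrow> 'n"

definition is_functor ::
    "('o, 'm) cat \<Rightarrow> ('p, 'n) cat \<Rightarrow> ('o, 'm, 'p, 'n) fctr \<Rightarrow> bool"
  where "is_functor K L F \<longleftrightarrow>
    is_category K \<and> is_category L \<and>
    (\<forall>a\<in>Obj K. on_obj F a \<in> Obj L) \<and>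
    (\<forall>f\<in>Arr K. on_arr F f \<in> Hom L (on_obj F (Dom K f)) (on_obj F (Cod K f))) \<and>
    (\<forall>a\<in>Obj K. on_arr F (Ide K a) = Ide L (on_obj F a)) \<and>
    (\<forall>f\<in>Arr K. \<forall>g\<in>Arr K. Cod K f = Dom K g \<longrightarrow>
       on_arr F (Comp K g f) = Comp L (on_arr F g) (on_arr F f))"

text \<open>
  The poset category of an order: its unique arrow from \<open>p\<close> to \<open>q\<close>, which exists iff
  \<open>p \<le> q\<close>, is encoded as the pair \<open>(p, q)\<close>.
\<close>

definition poset_cat :: "('a::order, 'a \<times> 'a) cat"
  where "poset_cat =
    \<lparr>Obj = UNIV, Arr = {(p, q). p \<le> q}, Dom = fst, Cod = snd,
     Ide = (\<lambda>p. (p, p)), Comp = (\<lambda>g f. (fst f, snd g))\<rparr>"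

lemma is_category_poset_cat: "is_category poset_cat"
  by (auto simp: is_category_def Hom_def poset_cat_def intro: order_trans)

text \<open>
  The algebra of propositions is the type \<open>'h\<close>. No relation between the consensus values and
  the propositions is required.
\<close>

record ('c, 'h, 'o, 'm) protocol =
  consensus_values :: "'c set"
  states_cat :: "('o, 'm) cat"
  estimator :: "('o, 'm, 'h, 'h \<times> 'h) fctr"

abbreviation estimate :: "('c, 'h, 'o, 'm) protocol \<Rightarrow> 'o \<Rightarrow> 'h"
  where "estimate P w \<equiv> on_obj (estimator P) w"

definition estimate_consensus_protocol :: "('c, 'h::heyting_algebra, 'o, 'm) protocol \<Rightarrow> bool"
  where "estimate_consensus_protocol P \<longleftrightarrow>
    is_functor (states_cat P) poset_cat (estimator P) \<and>
    (\<forall>w\<in>Obj (states_cat P). \<forall>p.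
       (estimate P w \<rightarrow>\<^sub>H p) = top \<longrightarrow> \<not>\<^sub>H (estimate P w \<rightarrow>\<^sub>H \<not>\<^sub>H p) = top)"

definition safe :: "('c, 'h::heyting_algebra, 'o, 'm) protocol \<Rightarrow> 'h \<Rightarrow> 'o \<Rightarrow> bool"
  where "safe P p w \<longleftrightarrow>
    (\<forall>w'\<in>Obj (states_cat P). \<forall>f\<in>Hom (states_cat P) w w'. (estimate P w' \<rightarrow>\<^sub>H p) = top)"

definition compatible :: "('c, 'h, 'o, 'm) protocol \<Rightarrow> 'o \<Rightarrow> 'o \<Rightarrow> bool"
  where "compatible P w\<^sub>1 w\<^sub>2 \<longleftrightarrow>
    (\<exists>w\<^sub>3\<in>Obj (states_cat P).
       Hom (states_cat P) w\<^sub>1 w\<^sub>3 \<noteq> {} \<and> Hom (states_cat P) w\<^sub>2 w\<^sub>3 \<noteq> {})"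

end

theory Submission
  imports Defs
begin

text \<open>
  Safety in a state speaks about all of its futures, so propositions that are safe in two
  compatible states are both implied by the estimate at a common future. The estimator axiom
  rules this out for inconsistent propositions: an estimate cannot imply both \<open>p\<close> and something
  below \<open>\<not>\<^sub>H p\<close> (\<open>estimate_not_le_inconsistent\<close>). The lemmas on the Heyting algebra translate between
  implications that equal \<open>top\<close> and the order.
\<close>

lemma himp_eq_top_iff:
  fixes p q :: "'a::heyting_algebra"
  shows "(p \<rightarrow>\<^sub>H q) = top \<longleftrightarrow> p \<le> q"
  using himp_residuation[of top p q] by (simp add: top_unique)

lemma le_hneg_iff:
  fixes p q :: "'a::heyting_algebra"
  shows "q \<le> \<not>\<^sub>H p \<longleftrightarrow> inf p q = bot"
  unfolding hneg_def himp_residuation[symmetric] by (simp add: bot_unique inf.commute)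

lemma hneg_eq_top_iff:
  fixes p :: "'a::heyting_algebra"
  shows "\<not>\<^sub>H p = top \<longleftrightarrow> p = bot"
  unfolding hneg_def himp_eq_top_iff by (rule bot_unique)

text \<open>
  Inconsistency of \<open>p\<close> and \<open>q\<close> means \<open>q \<le> \<not>\<^sub>H p\<close>, so an estimate below both would give the
  implication to \<open>\<not>\<^sub>H p\<close> the value \<open>top\<close>; the estimator axiom for \<open>p\<close> forces that value to be
  \<open>bot\<close>.
\<close>

lemma estimate_not_le_inconsistent:
  fixes P :: "('c, 'h::heyting_algebra, 'o, 'm) protocol"
  assumes nontrivial: "(bot::'h) \<noteq> top"
    and protocol: "estimate_consensus_protocol P"
    and state: "w \<in> Obj (states_cat P)"
    and inconsistent: "inf p q = bot"
    and p: "estimate P w \<le> p"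
  shows "\<not> estimate P w \<le> q"
proof
  assume "estimate P w \<le> q"
  also have "q \<le> \<not>\<^sub>H p"
    using inconsistent by (simp add: le_hneg_iff)
  finally have "(estimate P w \<rightarrow>\<^sub>H \<not>\<^sub>H p) = top"
    by (simp add: himp_eq_top_iff)
  moreover have "(estimate P w \<rightarrow>\<^sub>H \<not>\<^sub>H p) = bot"
    using protocol state p
    by (simp add: estimate_consensus_protocol_def himp_eq_top_iff hneg_eq_top_iff)
  ultimately show False
    using nontrivial by simp
qed

theorem theorem1p4:
  fixes P :: "('c, 'h::heyting_algebra, 'o, 'm) protocol"
    and p q :: 'h and w\<^sub>1 w\<^sub>2 :: 'o
  assumes nontrivial: "(bot::'h) \<noteq> top"
    and protocol: "estimate_consensus_protocol P"
    and inconsistent: "inf p q = bot"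
    and states: "w\<^sub>1 \<in> Obj (states_cat P)" "w\<^sub>2 \<in> Obj (states_cat P)"
    and compat: "compatible P w\<^sub>1 w\<^sub>2"
  shows "\<not> (safe P p w\<^sub>1 \<and> safe P q w\<^sub>2)"
proof
  assume safe: "safe P p w\<^sub>1 \<and> safe P q w\<^sub>2"
  obtain w\<^sub>3 where w\<^sub>3: "w\<^sub>3 \<in> Obj (states_cat P)"
    and "Hom (states_cat P) w\<^sub>1 w\<^sub>3 \<noteq> {}" "Hom (states_cat P) w\<^sub>2 w\<^sub>3 \<noteq> {}"
    using compat by (auto simp: compatible_def)
  with safe have "estimate P w\<^sub>3 \<le> p" "estimate P w\<^sub>3 \<le> q"
    by (auto simp: safe_def himp_eq_top_iff)
  then show False
    using estimate_not_le_inconsistent[OF nontrivial protocol w\<^sub>3 inconsistent] by blast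
qed

end
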